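(* Given a finite field $\mathbf{F}_q$ and integers $n \ge 2$, $d \ge 1$, there exists a smooth projective geometrically integral hypersurface $X$ in $\mathbf{P}^n$ over $\mathbf{F}_q$ such that for each $f \in S_1 \cup \dots \cup S_d$, $H_f \cap X$ fails to be smooth of dimension $n-2$.
   Context: $S = \mathbf{F}_q[x_0,\dots,x_n]$, $S_e$ its homogeneous polynomials of degree $e$; $H_f = \operatorname{Proj}(S/(f)) \subseteq \mathbf{P}^n$; $\cap$ is scheme-theoretic intersection. *)

theory Defs
  imports "HOL-Library.Poly_Mapping" "HOL-Algebra.Algebraic_Closure_Type"
          "HOL-Computational_Algebra.Factorial_Ring"
begin

text \<open>Multivariate polynomials: finitely supported maps from monomials
  (finitely supported exponent vectors, variable x_i has index i) to coefficients.\<close>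
type_synonym 'a mpoly = "(nat \<Rightarrow>\<^sub>0 nat) \<Rightarrow>\<^sub>0 'a"

definition mdeg :: "(nat \<Rightarrow>\<^sub>0 nat) \<Rightarrow> nat" where
  "mdeg m = (\<Sum>i\<in>Poly_Mapping.keys m. Poly_Mapping.lookup m i)"

definition S :: "nat \<Rightarrow> nat \<Rightarrow> ('a::zero) mpoly set" where
  "S n e = {f. \<forall>m\<in>Poly_Mapping.keys f. Poly_Mapping.keys m \<subseteq> {..n} \<and> mdeg m = e}"

definition mpeval :: "('a::comm_semiring_1) mpoly \<Rightarrow> (nat \<Rightarrow> 'a) \<Rightarrow> 'a" where
  "mpeval p x = (\<Sum>m\<in>Poly_Mapping.keys p. Poly_Mapping.lookup p m * (\<Prod>i\<in>Poly_Mapping.keys m. x i ^ Poly_Mapping.lookup m i))"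

definition pd :: "('a::comm_semiring_1) mpoly \<Rightarrow> nat \<Rightarrow> 'a mpoly" where
  "pd p j = (\<Sum>m\<in>Poly_Mapping.keys p. Poly_Mapping.single (m - Poly_Mapping.single j 1)
                              (of_nat (Poly_Mapping.lookup m j) * Poly_Mapping.lookup p m))"

definition lift :: "('a::field) mpoly \<Rightarrow> 'a alg_closure mpoly" where
  "lift p = Poly_Mapping.map to_ac p"

definition proj_point :: "nat \<Rightarrow> (nat \<Rightarrow> 'k::zero) \<Rightarrow> bool" where
  "proj_point n x \<longleftrightarrow> (\<exists>i\<le>n. x i \<noteq> 0)"

text \<open>V(F) is smooth (Jacobian criterion at all geometric points).\<close>
definition smooth_hypersurface :: "nat \<Rightarrow> ('a::field) mpoly \<Rightarrow> bool" where
  "smooth_hypersurface n F \<longleftrightarrow>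
     (\<forall>x. proj_point n x \<and> mpeval (lift F) x = 0 \<longrightarrow>
          (\<exists>i\<le>n. mpeval (pd (lift F) i) x \<noteq> 0))"

text \<open>V(f) \<inter> V(F) = Proj(S/(f,F)) is smooth of dimension n-2: at every
  geometric point of the intersection the 2 x (n+1) Jacobian matrix of (f,F)
  has rank 2, i.e. some 2x2 minor is nonzero.\<close>
definition isect_smooth_codim2 :: "nat \<Rightarrow> ('a::field) mpoly \<Rightarrow> 'a mpoly \<Rightarrow> bool" where
  "isect_smooth_codim2 n f F \<longleftrightarrow>
     (\<forall>x. proj_point n x \<and> mpeval (lift f) x = 0 \<and> mpeval (lift F) x = 0 \<longrightarrow>
        (\<exists>i\<le>n. \<exists>j\<le>n.
           mpeval (pd (lift f) i) x * mpeval (pd (lift F) j) x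
             \<noteq> mpeval (pd (lift f) j) x * mpeval (pd (lift F) i) x))"

end

theory Submission
  imports Defs
begin

text \<open>
  Let \<open>p\<close> be the characteristic. For forms \<open>A\<^sub>0, \<dots>, A\<^sub>n\<close> of equal degree and a power \<open>Q > 1\<close> of
  \<open>p\<close>, the form \<open>F = \<Sum> x\<^sub>i A\<^sub>i\<^sup>Q\<close> has partial derivatives \<open>A\<^sub>i\<^sup>Q\<close>, so \<open>V(F)\<close> is smooth as soon as
  the \<open>A\<^sub>i\<close> have no common zero. At a point \<open>P\<close> with coordinates in the field of \<open>Q\<close> elements,
  \<open>\<nabla>F(P) = A(P)\<close>; hence it suffices to choose on each \<open>V(f)\<close> one such point \<open>P\<close> and to interpolate:
  \<open>A(P) = \<nabla>f(P)\<close>, or, if \<open>\<nabla>f(P) = 0\<close>, any nonzero \<open>A(P)\<close> with \<open>\<Sum> P\<^sub>i A\<^sub>i(P) = 0\<close>.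
  The points are taken with \<open>x\<^sub>0 = 1\<close> and are separated by the function \<open>x\<^sub>2 - x\<^sub>1\<^sup>B\<close> with \<open>B > d\<close>, which
  attains every value on every \<open>V(f)\<close>; only the forms \<open>f = c x\<^sub>0\<^sup>e\<close> have no point with \<open>x\<^sub>0 = 1\<close>, and for
  these \<open>(0 : 1 : 0 : \<dots> : 0)\<close> is used.

  To avoid common zeros, \<open>n\<close> of the forms are given the shape \<open>x\<^sub>i\<^sup>r + x\<^sub>0 G\<^sub>i\<close> with \<open>i = 1, \<dots>, n\<close>.
  They have no common zero at infinity and finitely many elsewhere, and the remaining form is
  chosen not to vanish at the latter.
\<close>

abbreviation "lkp \<equiv> Poly_Mapping.lookup"
abbreviation "ks \<equiv> Poly_Mapping.keys"
abbreviation "sgl \<equiv> Poly_Mapping.single"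

subsection \<open>Evaluation, degree and partial derivatives\<close>

lemma mpoly_as_sum: "p = (\<Sum>m\<in>ks p. sgl m (lkp p m))"
proof (rule poly_mapping_eqI)
  fix k
  show "lkp p k = lkp (\<Sum>m\<in>ks p. sgl m (lkp p m)) k"
    by (auto simp: lookup_sum lookup_single when_def in_keys_iff)
qed

lemma mpoly_induct [case_names single add]:
  fixes p :: "'a::comm_monoid_add mpoly"
  assumes 1: "\<And>m c. P (sgl m c)" and 2: "\<And>p q. P p \<Longrightarrow> P q \<Longrightarrow> P (p + q)"
  shows "P p"
proof -
  have "P (\<Sum>m\<in>A. sgl m (lkp p m))" if "finite A" for A
    using that
  proof induction
    case empty
    show ?case using 1[of 0 0] by simp
  qed (simp add: 1 2)
  then show ?thesis by (subst mpoly_as_sum) simp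
qed

definition mev :: "(nat \<Rightarrow> 'b::comm_semiring_1) \<Rightarrow> (nat \<Rightarrow>\<^sub>0 nat) \<Rightarrow> 'b" where
  "mev x m = (\<Prod>i\<in>ks m. x i ^ lkp m i)"

text \<open>With the coefficient map as a parameter, one notion covers values at geometric points,
  restriction to curves and lines, and the grading substitution.\<close>

definition ev :: "('a::comm_semiring_1 \<Rightarrow> 'b::comm_semiring_1) \<Rightarrow> (nat \<Rightarrow> 'b) \<Rightarrow> 'a mpoly \<Rightarrow> 'b" where
  "ev \<phi> x p = (\<Sum>m\<in>ks p. \<phi> (lkp p m) * mev x m)"

lemma mev_superset:
  assumes "finite A" "ks m \<subseteq> A"
  shows "mev x m = (\<Prod>i\<in>A. x i ^ lkp m i)"
  unfolding mev_def using assms by (intro prod.mono_neutral_left) (auto simp: in_keys_iff)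

lemma mev_zero [simp]: "mev x 0 = 1"
  by (simp add: mev_def)

lemma mev_add: "mev x (m + m') = mev x m * mev x m'"
proof -
  let ?A = "ks m \<union> ks m'"
  have "ks (m + m') \<subseteq> ?A" by (rule Poly_Mapping.keys_add)
  then show ?thesis
    by (simp add: mev_superset[of ?A] lookup_add power_add prod.distrib)
qed

lemma mev_single [simp]: "mev x (sgl i k) = x i ^ k"
  by (cases "k = 0") (auto simp: mev_def)

lemma mdeg_superset:
  assumes "finite A" "ks m \<subseteq> A"
  shows "mdeg m = (\<Sum>i\<in>A. lkp m i)"
  unfolding mdeg_def using assms by (intro sum.mono_neutral_left) (auto simp: in_keys_iff)

lemma mdeg_zero [simp]: "mdeg 0 = 0"
  by (simp add: mdeg_def)

lemma mdeg_add: "mdeg (m + m') = mdeg m + mdeg m'"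
proof -
  let ?A = "ks m \<union> ks m'"
  have "ks (m + m') \<subseteq> ?A" by (rule Poly_Mapping.keys_add)
  then show ?thesis
    by (simp add: mdeg_superset[of ?A] lookup_add sum.distrib)
qed

lemma mdeg_single [simp]: "mdeg (sgl i k) = k"
  by (cases "k = 0") (auto simp: mdeg_def)

lemma mdeg_eq_0_iff: "mdeg m = 0 \<longleftrightarrow> m = 0"
  by (auto simp: mdeg_def in_keys_iff intro!: poly_mapping_eqI)

lemma monomial_split:
  fixes m :: "nat \<Rightarrow>\<^sub>0 nat"
  assumes "lkp m i \<ge> k"
  shows "m = (m - sgl i k) + sgl i k"
  using assms by (intro poly_mapping_eqI) (auto simp: lookup_add lookup_minus lookup_single when_def)

lemma keys_diff_monomial: "ks (m - m' :: nat \<Rightarrow>\<^sub>0 nat) \<subseteq> ks m"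
  by (auto simp: in_keys_iff lookup_minus)

locale coeff_hom =
  fixes \<phi> :: "'a::comm_ring_1 \<Rightarrow> 'b::comm_ring_1"
  assumes hom_0: "\<phi> 0 = 0" and hom_1: "\<phi> 1 = 1"
    and hom_add: "\<phi> (a + b) = \<phi> a + \<phi> b" and hom_mult: "\<phi> (a * b) = \<phi> a * \<phi> b"
begin

lemma ev_superset:
  assumes "finite A" "ks p \<subseteq> A"
  shows "ev \<phi> x p = (\<Sum>m\<in>A. \<phi> (lkp p m) * mev x m)"
  unfolding ev_def using assms by (intro sum.mono_neutral_left) (auto simp: in_keys_iff hom_0)

lemma ev_0 [simp]: "ev \<phi> x 0 = 0"
  by (simp add: ev_def)

lemma ev_single: "ev \<phi> x (sgl m c) = \<phi> c * mev x m"
  by (cases "c = 0") (auto simp: ev_def hom_0)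

lemma ev_1 [simp]: "ev \<phi> x 1 = 1"
  using ev_single[of x 0 1] by (simp add: hom_1)

lemma ev_add: "ev \<phi> x (p + q) = ev \<phi> x p + ev \<phi> x q"
proof -
  let ?A = "ks p \<union> ks q"
  have "ks (p + q) \<subseteq> ?A" by (rule Poly_Mapping.keys_add)
  then show ?thesis
    by (simp add: ev_superset[of ?A] lookup_add hom_add distrib_right sum.distrib)
qed

lemma ev_uminus: "ev \<phi> x (- p) = - ev \<phi> x p"
  using ev_add[of x p "- p"] by (simp add: eq_neg_iff_add_eq_0 add.commute)

lemma ev_diff: "ev \<phi> x (p - q) = ev \<phi> x p - ev \<phi> x q"
  using ev_add[of x p "- q"] by (simp add: ev_uminus)

lemma ev_mult: "ev \<phi> x (p * q) = ev \<phi> x p * ev \<phi> x q"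
proof (induction p rule: mpoly_induct)
  case (single m c)
  show ?case
  proof (induction q rule: mpoly_induct)
    case (single m' c')
    show ?case by (simp add: mult_single ev_single hom_mult mev_add)
  qed (simp add: distrib_left ev_add)
qed (simp add: distrib_right ev_add)

lemma ev_power: "ev \<phi> x (p ^ k) = ev \<phi> x p ^ k"
  by (induction k) (auto simp: ev_mult)

lemma ev_sum: "ev \<phi> x (sum f A) = (\<Sum>i\<in>A. ev \<phi> x (f i))"
  by (induction A rule: infinite_finite_induct) (auto simp: ev_add)

lemma ev_prod: "ev \<phi> x (prod f A) = (\<Prod>i\<in>A. ev \<phi> x (f i))"
  by (induction A rule: infinite_finite_induct) (auto simp: ev_mult)

lemmas ev_simps = ev_add ev_uminus ev_diff ev_mult ev_power ev_sum ev_prod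

end

section \<open>Formal partial derivatives\<close>

lemma pd_superset:
  assumes "finite A" "ks p \<subseteq> A"
  shows "pd p j = (\<Sum>m\<in>A. sgl (m - sgl j 1) (of_nat (lkp m j) * lkp p m))"
  unfolding pd_def using assms by (intro sum.mono_neutral_left) (auto simp: in_keys_iff)

lemma pd_0 [simp]: "pd 0 j = 0"
  by (simp add: pd_def)

lemma pd_single: "pd (sgl m c) j = sgl (m - sgl j 1) (of_nat (lkp m j) * c)"
  by (cases "c = 0") (auto simp: pd_def)

lemma pd_add: "pd (p + q) j = pd p j + pd q j"
proof -
  let ?A = "ks p \<union> ks q"
  have "ks (p + q) \<subseteq> ?A" by (rule Poly_Mapping.keys_add)
  then show ?thesis
    by (simp add: pd_superset[of ?A] lookup_add distrib_left single_add sum.distrib)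
qed

lemma pd_mult:
  fixes p q :: "'a::comm_ring_1 mpoly"
  shows "pd (p * q) j = pd p j * q + p * pd q j"
proof (induction p rule: mpoly_induct)
  case (single m c)
  show ?case
  proof (induction q rule: mpoly_induct)
    case (single m' c')
    have 1: "m + m' - sgl j 1 = (m - sgl j 1) + m'" if "lkp m j \<noteq> 0"
      using that
      by (intro poly_mapping_eqI) (auto simp: lookup_add lookup_minus lookup_single when_def)
    have 2: "m + m' - sgl j 1 = m + (m' - sgl j 1)" if "lkp m' j \<noteq> 0"
      using that
      by (intro poly_mapping_eqI) (auto simp: lookup_add lookup_minus lookup_single when_def)
    show ?case
    proof (cases "lkp m j = 0"; cases "lkp m' j = 0")
      assume "lkp m j \<noteq> 0" "lkp m' j \<noteq> 0"
      then have "m - sgl j 1 + m' = m + m' - sgl j 1" "m + (m' - sgl j 1) = m + m' - sgl j 1"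
        using 1 2 by metis+
      then show ?thesis
        by (simp add: mult_single pd_single lookup_add distrib_right algebra_simps
            flip: single_add)
    qed (simp_all add: mult_single pd_single lookup_add 1 2 mult.assoc mult.left_commute del: One_nat_def)
  qed (simp add: distrib_left pd_add algebra_simps)
qed (simp add: distrib_right pd_add algebra_simps)

lemma pd_1 [simp]: "pd 1 j = 0"
  using pd_single[of 0 1 j] by simp

lemma pd_sum: "pd (sum f A) j = (\<Sum>i\<in>A. pd (f i) j)"
  by (induction A rule: infinite_finite_induct) (auto simp: pd_add)

lemma pd_power:
  fixes p :: "'a::comm_ring_1 mpoly"
  shows "pd (p ^ k) j = of_nat k * p ^ (k - 1) * pd p j"
proof (induction k)
  case (Suc k)
  then show ?case
    by (cases k) (auto simp: pd_mult algebra_simps)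
qed simp

definition V :: "nat \<Rightarrow> 'a::comm_ring_1 mpoly" where
  "V i = sgl (sgl i 1) 1"

lemma pd_V: "pd (V i) j = (if i = j then 1 else 0)"
  by (auto simp: V_def pd_single lookup_single)

lemma (in coeff_hom) ev_V [simp]: "ev \<phi> x (V i) = x i"
  by (simp add: V_def ev_single hom_1)

section \<open>Spaces of homogeneous forms\<close>

lemma S_0 [simp]: "0 \<in> S n e"
  by (simp add: S_def)

lemma S_single: "ks m \<subseteq> {..n} \<Longrightarrow> mdeg m = e \<Longrightarrow> sgl m c \<in> S n e"
  by (cases "c = 0") (auto simp: S_def)

lemma S_1: "(1 :: 'a::comm_ring_1 mpoly) \<in> S n 0"
  using S_single[of 0 n 0 "1::'a"] by simp

lemma S_V: "i \<le> n \<Longrightarrow> V i \<in> S n 1"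
  unfolding V_def by (rule S_single) auto

lemma S_add: "p \<in> S n e \<Longrightarrow> q \<in> S n e \<Longrightarrow> p + q \<in> S n e"
  using Poly_Mapping.keys_add[of p q] unfolding S_def by blast

lemma S_uminus: "(p :: 'a::comm_ring_1 mpoly) \<in> S n e \<Longrightarrow> - p \<in> S n e"
  by (simp add: S_def in_keys_iff)

lemma S_diff: "(p :: 'a::comm_ring_1 mpoly) \<in> S n e \<Longrightarrow> q \<in> S n e \<Longrightarrow> p - q \<in> S n e"
  using S_add[of p n e "- q"] S_uminus[of q n e] by simp

lemma S_mult: 
  fixes p q :: "'a::comm_ring_1 mpoly"
  assumes p: "p \<in> S n e" and q: "q \<in> S n e'"
  shows "p * q \<in> S n (e + e')"
  unfolding S_def
proof (intro CollectI ballI)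
  fix m assume "m \<in> ks (p * q)"
  then obtain a b where ab: "a \<in> ks p" "b \<in> ks q" "m = a + b"
    using Poly_Mapping.keys_mult[of p q] by blast
  then show "ks m \<subseteq> {..n} \<and> mdeg m = e + e'"
    using p q Poly_Mapping.keys_add[of a b] by (fastforce simp: S_def mdeg_add)
qed

lemma S_mult': "(p::'a::comm_ring_1 mpoly) \<in> S n e \<Longrightarrow> q \<in> S n e' \<Longrightarrow> e'' = e + e' \<Longrightarrow> p * q \<in> S n e''"
  using S_mult by blast

lemma S_power: "(p::'a::comm_ring_1 mpoly) \<in> S n e \<Longrightarrow> p ^ k \<in> S n (e * k)"
  by (induction k) (auto simp: S_1 S_mult)

lemma S_power': "(p::'a::comm_ring_1 mpoly) \<in> S n e \<Longrightarrow> e' = e * k \<Longrightarrow> p ^ k \<in> S n e'"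
  using S_power by blast

lemma S_V_power: "i \<le> n \<Longrightarrow> V i ^ k \<in> S n k"
  using S_power[OF S_V, of i n k] by simp

lemma S_sum: "(\<And>i. i \<in> A \<Longrightarrow> f i \<in> S n e) \<Longrightarrow> sum f A \<in> S n e"
  by (induction A rule: infinite_finite_induct) (auto simp: S_add)

lemma S_prod:
  fixes f :: "'i \<Rightarrow> 'a::comm_ring_1 mpoly"
  assumes "finite A" "\<And>i. i \<in> A \<Longrightarrow> f i \<in> S n e"
  shows "prod f A \<in> S n (e * card A)"
  using assms by (induction A rule: finite_induct) (auto simp: S_1 S_mult)

lemma S_pd:
  assumes "p \<in> S n e"
  shows "pd p j \<in> S n (e - 1)"
  unfolding pd_def
proof (rule S_sum)
  fix m assume m: "m \<in> ks p"
  show "sgl (m - sgl j 1) (of_nat (lkp m j) * lkp p m) \<in> S n (e - 1)"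
  proof (cases "lkp m j = 0")
    case False
    then have "m = (m - sgl j 1) + sgl j 1" by (intro monomial_split) auto
    then have "mdeg m = mdeg (m - sgl j 1) + 1" by (metis mdeg_add mdeg_single)
    moreover have "ks (m - sgl j 1) \<subseteq> ks m" by (rule keys_diff_monomial)
    ultimately show ?thesis
      using m assms by (intro S_single) (auto simp: S_def)
  qed auto
qed

context coeff_hom
begin

lemma ev_scale:
  assumes "p \<in> S n e"
  shows "ev \<phi> (\<lambda>i. c * x i) p = c ^ e * ev \<phi> x p"
proof -
  have "mev (\<lambda>i. c * x i) m = c ^ e * mev x m" if "m \<in> ks p" for m
    using that assms by (auto simp: S_def mev_def power_mult_distrib prod.distrib mdeg_def power_sum)
  then show ?thesis by (simp add: ev_def sum_distrib_left mult_ac)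
qed

text \<open>On a monomial, \<open>x i\<close> times the i-th derivative multiplies by the i-th
  exponent, and the exponents add up to \<open>e\<close>. At a zero of a form the gradient is
  therefore orthogonal to the point.\<close>

lemma euler:
  assumes "p \<in> S n e"
  shows "(\<Sum>i\<le>n. x i * ev \<phi> x (pd p i)) = of_nat e * ev \<phi> x p"
proof -
  have of_nat: "\<phi> (of_nat k) = of_nat k" for k by (induction k) (auto simp: hom_0 hom_1 hom_add)
  have *: "x i * ev \<phi> x (sgl (m - sgl i 1) (of_nat (lkp m i) * lkp p m)) =
      of_nat (lkp m i) * (\<phi> (lkp p m) * mev x m)" for i m
  proof (cases "lkp m i = 0")
    case False
    then have "m = (m - sgl i 1) + sgl i 1" by (intro monomial_split) auto
    then have "mev x m = mev x (m - sgl i 1) * x i" by (metis mev_add mev_single power_one_right)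
    then show ?thesis by (simp add: ev_single hom_mult of_nat mult_ac)
  qed simp
  have "(\<Sum>i\<le>n. x i * ev \<phi> x (pd p i)) =
      (\<Sum>i\<le>n. \<Sum>m\<in>ks p. of_nat (lkp m i) * (\<phi> (lkp p m) * mev x m))"
    by (simp add: pd_def ev_sum sum_distrib_left * del: One_nat_def)
  also have "\<dots> = (\<Sum>m\<in>ks p. of_nat (\<Sum>i\<le>n. lkp m i) * (\<phi> (lkp p m) * mev x m))"
    by (subst sum.swap) (simp add: sum_distrib_right)
  also have "\<dots> = (\<Sum>m\<in>ks p. of_nat e * (\<phi> (lkp p m) * mev x m))"
    using assms by (intro sum.cong refl) (simp add: S_def flip: mdeg_superset)
  finally show ?thesis by (simp add: ev_def sum_distrib_left)
qed

end

abbreviation E :: "'a::field mpoly \<Rightarrow> (nat \<Rightarrow> 'a alg_closure) \<Rightarrow> 'a alg_closure" where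
  "E f x \<equiv> ev to_ac x f"

interpretation ac: coeff_hom "to_ac :: 'a::field \<Rightarrow> 'a alg_closure"
  by unfold_locales auto

lemma lookup_lift: "lkp (lift f) m = to_ac (lkp f m)"
  by (simp add: lift_def Poly_Mapping.map.rep_eq when_def)

lemma keys_lift [simp]: "ks (lift f) = ks f"
  by (auto simp: in_keys_iff lookup_lift)

lemma mpeval_lift: "mpeval (lift f) x = E f x"
  by (simp add: mpeval_def ev_def mev_def lookup_lift)

lemma pd_lift: "pd (lift f) j = lift (pd f j)"
proof (rule poly_mapping_eqI)
  fix k
  show "lkp (pd (lift f) j) k = lkp (lift (pd f j)) k"
    by (auto simp: pd_def lookup_lift lookup_sum to_ac_sum lookup_single when_def intro!: sum.cong)
qed

lemma mpeval_pd_lift: "mpeval (pd (lift f) j) x = E (pd f j) x"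
  by (simp add: pd_lift mpeval_lift)

subsection \<open>Finite subfields of the algebraic closure\<close>

text \<open>For \<open>k > 0\<close> this is membership in the subfield with
  \<open>CHAR('a) ^ k\<close> elements, encoded by Frobenius so that no subfield has to be
  constructed.\<close>

definition fixd :: "nat \<Rightarrow> 'a::{finite,field} alg_closure \<Rightarrow> bool" where
  "fixd k x \<longleftrightarrow> x ^ (CHAR('a) ^ k) = x"

lemma prime_CHAR_finite: "prime CHAR('a::{finite,field})"
  by (intro prime_CHAR_semidom finite_imp_CHAR_pos) simp

lemma CHAR_finite_ge_2: "CHAR('a::{finite,field}) \<ge> 2"
  by (rule prime_ge_2_nat[OF prime_CHAR_finite])

lemma CHAR_power_ge_2:
  assumes "k > 0"
  shows "CHAR('a::{finite,field}) ^ k \<ge> 2"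
proof -
  have "CHAR('a) ^ 1 \<le> CHAR('a) ^ k"
    using assms CHAR_finite_ge_2[where 'a='a] by (intro power_increasing) auto
  then show ?thesis using CHAR_finite_ge_2[where 'a='a] by simp
qed

lemma frob_add:
  fixes x y :: "'a::{finite,field} alg_closure"
  shows "(x + y) ^ (CHAR('a) ^ k) = x ^ (CHAR('a) ^ k) + y ^ (CHAR('a) ^ k)"
  by (rule freshmans_dream') (simp_all add: prime_CHAR_finite)

lemma frob_diff:
  fixes x y :: "'a::{finite,field} alg_closure"
  shows "(x - y) ^ (CHAR('a) ^ k) = x ^ (CHAR('a) ^ k) - y ^ (CHAR('a) ^ k)"
  using frob_add[of "x - y" y k] by (simp add: algebra_simps)

lemma fixd_0 [simp]: "fixd k 0"
  using CHAR_finite_ge_2[where 'a='a] by (simp add: fixd_def)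

lemma fixd_1 [simp]: "fixd k 1"
  by (simp add: fixd_def)

lemma fixd_add: "fixd k x \<Longrightarrow> fixd k y \<Longrightarrow> fixd k (x + y)"
  by (simp add: fixd_def frob_add)

lemma fixd_diff: "fixd k x \<Longrightarrow> fixd k y \<Longrightarrow> fixd k (x - y)"
  by (simp add: fixd_def frob_diff)

lemma fixd_mult: "fixd k x \<Longrightarrow> fixd k y \<Longrightarrow> fixd k (x * y)"
  by (simp add: fixd_def power_mult_distrib)

lemma fixd_power: "fixd k x \<Longrightarrow> fixd k (x ^ j)"
  by (induction j) (auto intro: fixd_mult)

lemma fixd_sum: "(\<And>i. i \<in> A \<Longrightarrow> fixd k (f i)) \<Longrightarrow> fixd k (sum f A)"
  by (induction A rule: infinite_finite_induct) (auto intro: fixd_add)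

lemma fixd_prod: "(\<And>i. i \<in> A \<Longrightarrow> fixd k (f i)) \<Longrightarrow> fixd k (prod f A)"
  by (induction A rule: infinite_finite_induct) (auto intro: fixd_mult)

lemma power_fixd:
  fixes x :: "'a::{finite,field} alg_closure"
  assumes "fixd k x"
  shows "x ^ ((CHAR('a) ^ k) ^ j) = x"
proof (induction j)
  case (Suc j)
  have "x ^ ((CHAR('a) ^ k) ^ Suc j) = (x ^ (CHAR('a) ^ k)) ^ ((CHAR('a) ^ k) ^ j)"
    by (simp flip: power_mult)
  then show ?case using Suc assms by (simp add: fixd_def)
qed simp

lemma fixd_dvd: "fixd k x \<Longrightarrow> k dvd l \<Longrightarrow> fixd l x"
  using power_fixd by (fastforce simp: fixd_def power_mult elim!: dvdE)

lemma fixd_E: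
  fixes f :: "'a::{finite,field} mpoly"
  assumes "f \<in> S n e" "\<And>c::'a. fixd k (to_ac c)" "\<And>i. i \<le> n \<Longrightarrow> fixd k (x i)"
  shows "fixd k (E f x)"
  unfolding ev_def mev_def using assms
  by (intro fixd_sum fixd_mult fixd_prod fixd_power) (auto simp: S_def)

lemma finite_polys_degree_le: "finite {q :: 'a::{finite,zero} poly. Polynomial.degree q \<le> d}"
proof -
  have "{q :: 'a poly. Polynomial.degree q \<le> d} \<subseteq> Poly ` {xs. set xs \<subseteq> UNIV \<and> length xs \<le> Suc d}"
  proof
    fix q :: "'a poly" assume "q \<in> {q. Polynomial.degree q \<le> d}"
    then have "length (coeffs q) \<le> Suc d"
      by (cases "q = 0") (auto simp: length_coeffs_degree)
    then show "q \<in> Poly ` {xs. set xs \<subseteq> UNIV \<and> length xs \<le> Suc d}"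
      by (intro image_eqI[of _ _ "coeffs q"]) auto
  qed
  then show ?thesis by (rule finite_subset) (intro finite_imageI finite_lists_length_le, simp)
qed

text \<open>Since \<open>x\<close> is a root of a nonzero \<open>p\<close> over the finite field,
  every power of \<open>x\<close> is the value of a remainder modulo \<open>p\<close>, and these are
  finitely many.\<close>

lemma finite_powers: "finite (range (\<lambda>i. (x :: 'a::{finite,field} alg_closure) ^ i))"
proof -
  obtain p :: "'a poly" where p: "p \<noteq> 0" "poly (map_poly to_ac p) x = 0"
    by (rule alg_closure_algebraic)
  let ?P = "\<lambda>q. poly (map_poly to_ac q) x"
  have add: "?P (q + r) = ?P q + ?P r" for q r :: "'a poly"
  proof -
    have "map_poly to_ac (q + r) = map_poly to_ac q + map_poly to_ac r"
      by (rule poly_eqI) (simp add: coeff_map_poly)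
    then show ?thesis by simp
  qed
  have mult: "?P (q * r) = ?P q * ?P r" for q r :: "'a poly"
  proof -
    have "map_poly to_ac (q * r) = map_poly to_ac q * map_poly to_ac r"
      by (rule poly_eqI) (simp add: coeff_map_poly coeff_mult to_ac_sum)
    then show ?thesis by simp
  qed
  have *: "x ^ i = ?P (Polynomial.monom 1 i mod p)" for i
  proof -
    have "x ^ i = ?P (Polynomial.monom 1 i)"
      by (simp add: map_poly_monom poly_monom)
    also have "\<dots> = ?P (Polynomial.monom 1 i div p * p + Polynomial.monom 1 i mod p)"
      by simp
    also have "\<dots> = ?P (Polynomial.monom 1 i mod p)"
      unfolding add mult by (simp add: p)
    finally show ?thesis .
  qed
  have "range (\<lambda>i. x ^ i) \<subseteq> ?P ` {q. Polynomial.degree q \<le> Polynomial.degree p}"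
  proof safe
    fix i
    have "Polynomial.degree (Polynomial.monom 1 i mod p) \<le> Polynomial.degree p"
      using degree_mod_less[OF p(1), of "Polynomial.monom 1 i"] by auto
    then show "x ^ i \<in> ?P ` {q. Polynomial.degree q \<le> Polynomial.degree p}"
      unfolding * by blast
  qed
  then show ?thesis
    by (rule finite_subset) (intro finite_imageI finite_polys_degree_le)
qed

text \<open>Two Frobenius iterates of \<open>x\<close> agree by the pigeonhole principle; Frobenius
  is additive and injective, so the lower iterate can be cancelled.\<close>

lemma ex_fixd: "\<exists>k>0. fixd k (x :: 'a::{finite,field} alg_closure)"
proof -
  let ?p = "CHAR('a)"
  have "finite (range (\<lambda>i. x ^ (?p ^ i)))"
    by (rule finite_subset[OF _ finite_powers[of x]]) auto
  then have "\<not> inj (\<lambda>i. x ^ (?p ^ i))"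
    using finite_imageD infinite_UNIV_nat by blast
  then obtain i j where ij: "i < j" "x ^ (?p ^ i) = x ^ (?p ^ j)"
    by (metis injI nat_neq_iff)
  have "?p ^ j = ?p ^ (j - i) * ?p ^ i"
    using ij(1) by (simp flip: power_add)
  then have "(x ^ (?p ^ (j - i)) - x) ^ (?p ^ i) = 0"
    using ij by (simp add: frob_diff flip: power_mult)
  then have "fixd (j - i) x" by (simp add: fixd_def)
  then show ?thesis using ij by (intro exI[of _ "j - i"]) auto
qed

lemma ex_fixd_finite:
  fixes U :: "'a::{finite,field} alg_closure set"
  assumes "finite U" "k > 0"
  shows "\<exists>l>0. k dvd l \<and> (\<forall>x\<in>U. fixd l x)"
  using assms(1)
proof induction
  case (insert x U)
  then obtain l where l: "l > 0" "k dvd l" "\<And>x. x \<in> U \<Longrightarrow> fixd l x" by blast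
  obtain j where j: "j > 0" "fixd j x" using ex_fixd by blast
  show ?case
  proof (intro exI[of _ "l * j"] conjI ballI)
    fix y assume "y \<in> insert x U"
    then show "fixd (l * j) y"
      using l j by (metis fixd_dvd dvd_triv_left dvd_triv_right insertE)
  qed (use l j in auto)
qed (use assms(2) in auto)

section \<open>Finiteness of the spaces of forms and of affine common zeros\<close>

lemma finite_S: "finite (S n D :: 'a::{finite,zero} mpoly set)"
proof -
  define M where "M = {m. ks m \<subseteq> {..n} \<and> mdeg m = D}"
  have "lkp m \<in> {g. \<forall>i. (i \<in> {..n} \<longrightarrow> g i \<in> {..D}) \<and> (i \<notin> {..n} \<longrightarrow> g i = 0)}" if "m \<in> M" for m
  proof -
    have "mdeg m = (\<Sum>i\<le>n. lkp m i)" using that by (intro mdeg_superset) (auto simp: M_def)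
    then have "lkp m i \<le> D" if "i \<le> n" for i
      using \<open>m \<in> M\<close> that member_le_sum[of i "{..n}" "lkp m"] by (auto simp: M_def)
    then show ?thesis using that by (auto simp: M_def not_in_keys_iff_lookup_eq_zero)
  qed
  then have "M \<subseteq> lkp -` {g. \<forall>i. (i \<in> {..n} \<longrightarrow> g i \<in> {..D}) \<and> (i \<notin> {..n} \<longrightarrow> g i = 0)}"
    by blast
  then have M: "finite M"
    by (rule finite_subset)
      (intro finite_vimageI finite_set_of_finite_funs, auto intro!: injI poly_mapping_eqI)
  have "S n D \<subseteq> lkp -` {g :: _ \<Rightarrow> 'a. \<forall>m. (m \<in> M \<longrightarrow> g m \<in> UNIV) \<and> (m \<notin> M \<longrightarrow> g m = 0)}"
    by (auto simp: S_def M_def in_keys_iff)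
  then show ?thesis
    by (rule finite_subset)
      (intro finite_vimageI finite_set_of_finite_funs M, auto intro!: injI poly_mapping_eqI)
qed

text \<open>The values at \<open>w\<close> of the forms of degree \<open>D\<close> make up a finite set which stops growing with \<open>D\<close>,
  since \<open>w\<^sub>i\<^sup>r\<close> is the value of a form of degree \<open>r - 1\<close>. As it contains all powers of \<open>w\<^sub>i\<close>, two of
  these powers with bounded exponents agree.\<close>

lemma finite_common_zeros:
  fixes G :: "nat \<Rightarrow> 'a::{finite,field} mpoly"
  assumes r: "r > 0" and G: "\<And>i. i \<in> {1..n} \<Longrightarrow> G i \<in> S n (r - 1)"
  shows "\<exists>U. finite U \<and> (\<forall>w. w 0 = 1 \<longrightarrow> (\<forall>i\<in>{1..n}. E (V i ^ r + V 0 * G i) w = 0) \<longrightarrow>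
           (\<forall>i\<le>n. w i \<in> U))"
proof -
  \<comment> \<open>A monomial of degree above \<open>D0\<close> in the \<open>n + 1\<close>
    variables has an exponent at least \<open>r\<close>, which is where the degree can be
    lowered.\<close>
  define D0 where "D0 = Suc n * r"
  define N where "N = card (S n D0 :: 'a mpoly set)"
  \<comment> \<open>\<open>N\<close> bounds the number of values independently of \<open>w\<close>,
    so these finitely many equations serve all common zeros at once.\<close>
  define U :: "'a alg_closure set" where
    "U = (\<Union>b\<in>{..N}. \<Union>a\<in>{..<b}. {x. poly (Polynomial.monom 1 b - Polynomial.monom 1 a) x = 0})"
  have "finite U" unfolding U_def
  proof (intro finite_UN_I finite_atMost finite_lessThan poly_roots_finite)
    fix a b :: nat assume "b \<in> {..N}" "a \<in> {..<b}"
    then have "Polynomial.coeff (Polynomial.monom 1 b - Polynomial.monom (1::'a alg_closure) a) b = 1" by auto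
    then show "Polynomial.monom 1 b - Polynomial.monom (1::'a alg_closure) a \<noteq> 0"
      by (metis coeff_0 zero_neq_one)
  qed
  moreover have "w i \<in> U" if w0: "w 0 = 1" and w: "\<And>i. i \<in> {1..n} \<Longrightarrow> E (V i ^ r + V 0 * G i) w = 0"
    and i: "i \<le> n" for w i
  proof -
    have wr: "w i ^ r = - E (G i) w" if "i \<in> {1..n}" for i
      using w[OF that] w0 by (simp add: ac.ev_simps eq_neg_iff_add_eq_0)
    have mono: "\<exists>g\<in>S n D. E g w = E (sgl m c) w"
      if D: "D \<ge> D0" and m: "ks m \<subseteq> {..n}" "mdeg m = Suc D" for D m and c :: 'a
    proof -
      have "\<exists>i\<le>n. lkp m i \<ge> r"
      proof (rule ccontr)
        assume "\<not> ?thesis"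
        then have "(\<Sum>i\<le>n. lkp m i) \<le> (\<Sum>i\<le>n. r)" by (intro sum_mono) auto
        then show False using m D mdeg_superset[of "{..n}" m] by (simp add: D0_def)
      qed
      then obtain i where i: "i \<le> n" "lkp m i \<ge> r" by blast
      show ?thesis
      proof (cases "i = 0")
        case True
        have eq: "m = (m - sgl 0 1) + sgl 0 1" using i r True by (intro monomial_split) auto
        have "ks (m - sgl 0 1) \<subseteq> {..n}" using m keys_diff_monomial by blast
        moreover have "mdeg (m - sgl 0 1) = D"
          using m(2) by (subst (asm) eq) (simp add: mdeg_add)
        ultimately have "sgl (m - sgl 0 1) c \<in> S n D" by (rule S_single)
        moreover have "E (sgl (m - sgl 0 1) c) w = E (sgl m c) w"
          by (subst (2) eq) (simp add: ac.ev_single mev_add w0)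
        ultimately show ?thesis by blast
      next
        case False
        have eq: "m = (m - sgl i r) + sgl i r" using i by (intro monomial_split) auto
        have "ks (m - sgl i r) \<subseteq> {..n}" using m keys_diff_monomial by blast
        moreover have mr: "mdeg (m - sgl i r) + r = Suc D"
          using m(2) by (subst (asm) eq) (simp add: mdeg_add)
        ultimately have "sgl (m - sgl i r) c \<in> S n (Suc D - r)" by (intro S_single) auto
        then have "sgl (m - sgl i r) (- c) * G i \<in> S n D"
          using S_mult[OF S_single[of "m - sgl i r" n "Suc D - r" "- c"] G[of i]] False i r mr
            \<open>ks (m - sgl i r) \<subseteq> {..n}\<close>
          by auto
        moreover have "E (sgl (m - sgl i r) (- c) * G i) w = E (sgl m c) w"
          using False i by (subst (2) eq) (simp add: ac.ev_single ac.ev_mult mev_add wr)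
        ultimately show ?thesis by blast
      qed
    qed
    have step: "\<exists>g\<in>S n D. E g w = E f w" if D: "D \<ge> D0" and f: "f \<in> S n (Suc D)" for D f
    proof -
      have "\<forall>m\<in>ks f. \<exists>g\<in>S n D. E g w = E (sgl m (lkp f m)) w"
        using f D by (intro ballI mono) (auto simp: S_def)
      then obtain g where g: "\<And>m. m \<in> ks f \<Longrightarrow> g m \<in> S n D \<and> E (g m) w = E (sgl m (lkp f m)) w"
        by metis
      show ?thesis
      proof (intro bexI)
        show "sum g (ks f) \<in> S n D" using g by (intro S_sum) auto
        show "E (sum g (ks f)) w = E f w"
          using g by (subst (3) mpoly_as_sum) (simp add: ac.ev_sum)
      qed
    qed
    have all: "\<exists>g\<in>S n D0. E g w = E f w" if "f \<in> S n D" for D f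
    proof (cases "D \<le> D0")
      case True
      then have "f * V 0 ^ (D0 - D) \<in> S n D0"
        using that by (intro S_mult'[OF _ S_V_power]) auto
      then show ?thesis using w0 by (intro bexI[of _ "f * V 0 ^ (D0 - D)"]) (auto simp: ac.ev_simps)
    next
      case False
      then have "D0 \<le> D" by simp
      then show ?thesis using that
      proof (induction D arbitrary: f rule: dec_induct)
        case (step D)
        then show ?case using \<open>\<And>D f. D \<ge> D0 \<Longrightarrow> f \<in> S n (Suc D) \<Longrightarrow> \<exists>g\<in>S n D. E g w = E f w\<close> by metis
      qed auto
    qed
    have "w i ^ j \<in> (\<lambda>f. E f w) ` S n D0" for j
    proof -
      obtain g where g: "g \<in> S n D0" "E g w = E (V i ^ j) w"
        using all[OF S_V_power[OF i, of j]] by blast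
      have "w i ^ j = E g w" unfolding g(2) by (simp add: ac.ev_power)
      then show ?thesis using g(1) by (rule image_eqI)
    qed
    then have sub: "(\<lambda>j. w i ^ j) ` {..N} \<subseteq> (\<lambda>f. E f w) ` S n D0" by blast
    have "card ((\<lambda>j. w i ^ j) ` {..N}) \<le> N"
      using card_mono[OF _ sub] card_image_le[OF finite_S[of n D0], of "\<lambda>f. E f w"]
      by (simp add: N_def finite_S)
    then have "\<not> inj_on (\<lambda>j. w i ^ j) {..N}"
      by (auto dest: card_image)
    then obtain a b where ab: "a < b" "b \<le> N" "w i ^ a = w i ^ b"
      unfolding inj_on_def by (metis atMost_iff nat_neq_iff)
    then have "w i \<in> {x. poly (Polynomial.monom 1 b - Polynomial.monom 1 a) x = 0}"
      by (simp add: poly_monom)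
    then show ?thesis unfolding U_def using ab by blast
  qed
  ultimately show ?thesis by blast
qed

subsection \<open>Points on hypersurfaces and interpolation\<close>

lemma digits_unique:
  fixes a b :: "nat \<Rightarrow> nat"
  assumes "\<And>i. i < k \<Longrightarrow> a i < B" "\<And>i. i < k \<Longrightarrow> b i < B"
    and "(\<Sum>i<k. a i * B ^ i) = (\<Sum>i<k. b i * B ^ i)" and "i < k"
  shows "a i = b i"
  using assms
proof (induction k arbitrary: a b i)
  case (Suc k)
  have *: "(\<Sum>i<Suc k. c i * B ^ i) = c 0 + B * (\<Sum>i<k. c (Suc i) * B ^ i)" for c :: "nat \<Rightarrow> nat"
    by (subst sum.lessThan_Suc_shift) (simp add: sum_distrib_left mult_ac)
  have eq: "a 0 + B * (\<Sum>i<k. a (Suc i) * B ^ i) = b 0 + B * (\<Sum>i<k. b (Suc i) * B ^ i)"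
    using Suc.prems(3) unfolding * .
  have B: "a 0 < B" "b 0 < B" using Suc.prems by auto
  have "(a 0 + B * (\<Sum>i<k. a (Suc i) * B ^ i)) mod B = (b 0 + B * (\<Sum>i<k. b (Suc i) * B ^ i)) mod B"
    unfolding eq ..
  then have 0: "a 0 = b 0" using B by simp
  then have "(\<Sum>i<k. a (Suc i) * B ^ i) = (\<Sum>i<k. b (Suc i) * B ^ i)"
    using eq B by simp
  moreover have "a (Suc i) < B" "b (Suc i) < B" if "i < k" for i
    using Suc.prems(1,2) that by simp_all
  ultimately have *: "a (Suc i) = b (Suc i)" if "i < k" for i
    using Suc.IH[of "\<lambda>i. a (Suc i)" "\<lambda>i. b (Suc i)" i] that by blast
  show ?case
  proof (cases i)
    case (Suc j)
    then show ?thesis using *[of j] \<open>i < Suc k\<close> by simp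
  qed (simp add: 0)
qed simp

lemma poly_ev: "poly (ev (\<lambda>a. [:to_ac a:]) Z f) t = E f (\<lambda>i. poly (Z i) t)"
  by (simp add: ev_def mev_def poly_sum poly_prod)

text \<open>The zero is found on the curve \<open>(1, t, c + t\<^sup>B, t\<^bsup>B*B\<^esup>, \<dots>)\<close>. By uniqueness of digits in base \<open>B\<close>,
  distinct monomials of \<open>f\<close> restrict to polynomials in \<open>t\<close> of distinct degrees.\<close>

lemma ex_point:
  fixes f :: "'a::field mpoly"
  assumes f: "f \<in> S n e" and n: "2 \<le> n" and B: "e < B" and m0: "m0 \<in> ks f" "m0 \<noteq> sgl 0 e"
  shows "\<exists>x. x 0 = 1 \<and> x 2 - x 1 ^ B = c \<and> E f x = 0"
proof -
  \<comment> \<open>\<open>w i\<close> is the degree in \<open>t\<close> of coordinate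
    \<open>i\<close>. The shift of coordinate 2 by \<open>c\<close> affects neither its degree
    \<open>B\<close> nor its leading coefficient.\<close>
  define w :: "nat \<Rightarrow> nat" where "w i = (if i = 0 then 0 else B ^ (i - 1))" for i
  define Z :: "nat \<Rightarrow> 'a alg_closure poly" where
    "Z i = (if i = 2 then Polynomial.monom 1 B + [:c:] else Polynomial.monom 1 (w i))" for i
  define wt where "wt m = (\<Sum>i\<in>ks m. lkp m i * w i)" for m
  have Z: "Polynomial.degree (Z i) = w i \<and> Polynomial.coeff (Z i) (w i) = 1" for i
  proof (cases "i = 2")
    case True
    have "Polynomial.degree (Polynomial.monom 1 B + [:c:]) = B"
      using B by (subst degree_add_eq_left) (auto simp: degree_monom_eq)
    then show ?thesis using True B by (simp add: Z_def w_def coeff_pCons split: nat.split)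
  qed (simp add: Z_def degree_monom_eq)
  have lc: "Polynomial.lead_coeff (Z i) = 1" for i using Z[of i] by metis
  then have nz: "Z i \<noteq> 0" for i by (metis leading_coeff_0_iff zero_neq_one)
  have deg: "Polynomial.degree (mev Z m) = wt m" for m
    unfolding mev_def wt_def using Z nz
    by (subst degree_prod_sum_eq) (auto simp: degree_power_eq)
  have mlc: "Polynomial.coeff (mev Z m) (wt m) = 1" for m
    unfolding deg[symmetric] unfolding mev_def by (simp add: lead_coeff_prod lead_coeff_power lc)
  have inj: "m = m'" if m: "ks m \<subseteq> {..n}" "mdeg m = e" "ks m' \<subseteq> {..n}" "mdeg m' = e" "wt m = wt m'" for m m'
  proof -
    have wt: "wt m = (\<Sum>i<n. lkp m (Suc i) * B ^ i)" if "ks m \<subseteq> {..n}" for m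
    proof -
      have "wt m = (\<Sum>i\<le>n. lkp m i * w i)"
        unfolding wt_def using that by (intro sum.mono_neutral_left) (auto simp: in_keys_iff)
      then show ?thesis by (simp add: sum.atMost_shift w_def)
    qed
    have md: "mdeg m = lkp m 0 + (\<Sum>i<n. lkp m (Suc i))" if "ks m \<subseteq> {..n}" for m
      using mdeg_superset[of "{..n}" m] that by (simp add: sum.atMost_shift)
    have lt: "lkp m (Suc i) < B" if "ks m \<subseteq> {..n}" "mdeg m = e" "i < n" for m i
      using member_le_sum[of i "{..<n}" "\<lambda>i. lkp m (Suc i)"] that md[of m] B by auto
    have s: "lkp m (Suc i) = lkp m' (Suc i)" if "i < n" for i
      by (rule digits_unique[of n _ B]) (use m lt wt that in auto)
    \<comment> \<open>The exponent of \<open>x 0\<close> does not enter the weight; the common total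
      degree determines it.\<close>
    then have "lkp m 0 = lkp m' 0" using md[of m] md[of m'] m by auto
    then have "lkp m i = lkp m' i" if "i \<le> n" for i using s that by (cases i) auto
    moreover have "lkp m i = lkp m' i" if "\<not> i \<le> n" for i
      using that m by (metis atMost_iff in_keys_iff subsetD)
    ultimately show ?thesis by (intro poly_mapping_eqI) metis
  qed
  let ?M = "Max (wt ` ks f)"
  have "?M \<in> wt ` ks f" using m0 by (intro Max_in) auto
  then obtain m1 where m1: "m1 \<in> ks f" "wt m1 = ?M" by auto
  have le: "wt m \<le> wt m1" if "m \<in> ks f" for m
    unfolding m1(2) using that by (intro Max_ge) auto
  let ?P = "ev (\<lambda>a. [:to_ac a:]) Z f"
  have "Polynomial.coeff ?P (wt m1) = (\<Sum>m\<in>ks f. to_ac (lkp f m) * Polynomial.coeff (mev Z m) (wt m1))"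
    by (simp add: ev_def Polynomial.coeff_sum)
  also have "\<dots> = (\<Sum>m\<in>ks f. if m = m1 then to_ac (lkp f m) else 0)"
  proof (intro sum.cong refl)
    fix m assume m: "m \<in> ks f"
    show "to_ac (lkp f m) * Polynomial.coeff (mev Z m) (wt m1) = (if m = m1 then to_ac (lkp f m) else 0)"
    proof (cases "m = m1")
      case False
      then have "wt m \<noteq> wt m1" using inj[of m m1] m m1(1) f unfolding S_def by blast
      then have "wt m < wt m1" using le[OF m] by simp
      then show ?thesis using False by (simp add: coeff_eq_0 deg)
    qed (simp add: mlc)
  qed
  also have "\<dots> \<noteq> 0" using m1 by (simp add: in_keys_iff)
  finally have "wt m1 \<le> Polynomial.degree ?P" by (rule le_degree)
  \<comment> \<open>In degree \<open>e\<close> only the power of \<open>x 0\<close> has weight 0, so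
    the presence of \<open>m0\<close> makes the restriction to the curve nonconstant.\<close>
  moreover have "wt m0 \<noteq> 0"
  proof
    assume "wt m0 = 0"
    moreover have "wt (sgl 0 e) = 0" by (auto simp: wt_def w_def in_keys_iff lookup_single when_def)
    ultimately show False using inj[of m0 "sgl 0 e"] m0 f
      by (cases "e = 0") (auto simp: S_def)
  qed
  ultimately have "Polynomial.degree ?P > 0" using le[OF m0(1)] by linarith
  then obtain t where "poly ?P t = 0" using alg_closed_imp_poly_has_root by blast
  then have "E f (\<lambda>i. poly (Z i) t) = 0" by (simp add: poly_ev)
  moreover have "poly (Z 0) t = 1" "poly (Z 2) t - poly (Z 1) t ^ B = c"
    by (auto simp: Z_def w_def poly_monom)
  ultimately show ?thesis by (intro exI[of _ "\<lambda>i. poly (Z i) t"]) simp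
qed

text \<open>The values of \<open>g\<close> at \<open>x\<close> are to become the gradient of the
  hypersurface: orthogonality to \<open>x\<close> will put \<open>x\<close> on it, and the minors
  express tangency, also where the gradient of \<open>f\<close> vanishes. \<open>fixd k\<close>
  makes later Frobenius powers harmless.\<close>

definition tang :: "nat \<Rightarrow> nat \<Rightarrow> (nat \<Rightarrow> 'a::{finite,field} alg_closure) \<Rightarrow> 'a mpoly \<Rightarrow>
    (nat \<Rightarrow> 'a mpoly) \<Rightarrow> bool" where
  "tang n k x f g \<longleftrightarrow> x 0 = 1 \<and> (\<forall>i\<le>n. fixd k (x i)) \<and> E f x = 0 \<and> (\<exists>i\<le>n. E (g i) x \<noteq> 0) \<and>
     (\<Sum>i\<le>n. x i * E (g i) x) = 0 \<and>
     (\<forall>i\<le>n. \<forall>j\<le>n. E (pd f i) x * E (g j) x = E (pd f j) x * E (g i) x)"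

lemma tang_cong:
  assumes "tang n k x f g" "k dvd l" "\<And>i. i \<le> n \<Longrightarrow> E (h i) x = E (g i) x"
  shows "tang n l x f h"
  using assms fixd_dvd[of k _ l] unfolding tang_def by auto

text \<open>Forms are treated one at a time. The new point is chosen with
  \<open>x 2 - x 1 ^ B\<close> outside the field of all earlier points, so a correction at it can
  leave their values untouched.\<close>

lemma interpolation:
  fixes Fs :: "'a::{finite,field} mpoly set"
  assumes fin: "finite Fs" and n: "2 \<le> n"
    and Fs: "\<And>f. f \<in> Fs \<Longrightarrow> \<exists>e<B. f \<in> S n e \<and> (\<exists>m\<in>ks f. m \<noteq> sgl 0 e)"
  shows "\<exists>g D k. k > 0 \<and> (\<forall>i. g i \<in> S n D) \<and> (\<forall>f\<in>Fs. \<exists>x. tang n k x f g)"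
  using fin Fs
proof (induction Fs rule: finite_induct)
  case empty
  show ?case by (intro exI[of _ "\<lambda>_. 0"] exI[of _ 1]) auto
next
  case (insert f Fs)
  then obtain g D k where k: "k > 0" and g: "\<And>i. g i \<in> S n D"
    and Fs: "\<And>f. f \<in> Fs \<Longrightarrow> \<exists>x. tang n k x f g"
    by (metis insertI2)
  obtain e m where e: "e < B" "f \<in> S n e" and m: "m \<in> ks f" "m \<noteq> sgl 0 e"
    using insert.prems by blast
  define R where "R = CHAR('a) ^ k"
  have R: "R \<ge> 2" unfolding R_def using k by (rule CHAR_power_ge_2)
  \<comment> \<open>An Artin-Schreier element, outside the field with \<open>R\<close> elements. The
    right-hand side 1 lets the separating form \<open>h\<close> have coefficients in
    \<open>'a\<close>.\<close>
  obtain c :: "'a alg_closure" where c: "c ^ R - c = 1"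
  proof -
    let ?p = "Polynomial.monom 1 R + [:-1, -1 :: 'a alg_closure:]"
    have "Polynomial.degree ?p = R"
      using R by (subst degree_add_eq_left) (auto simp: degree_monom_eq)
    then obtain c where "poly ?p c = 0"
      using alg_closed_imp_poly_has_root[of ?p] R by auto
    then show ?thesis by (intro that[of c]) (simp add: poly_monom algebra_simps)
  qed
  obtain x where x0: "x 0 = 1" and xc: "x 2 - x 1 ^ B = c" and fx: "E f x = 0"
    using ex_point[OF e(2) n e(1) m] by blast
  obtain l where l: "l > 0" "k dvd l" "\<And>y. y \<in> x ` {..n} \<Longrightarrow> fixd l y"
    using ex_fixd_finite[of "x ` {..n}" k] k by auto
  have "\<exists>v D'. (\<forall>i. v i \<in> S n D') \<and> tang n l x f v"
  proof (cases "\<exists>i\<le>n. E (pd f i) x \<noteq> 0")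
    case True
    have "tang n l x f (pd f)"
      using True x0 fx l ac.euler[OF e(2), of x] by (simp add: tang_def mult.commute)
    then show ?thesis using S_pd[OF e(2)] by blast
  next
    case False
    \<comment> \<open>Orthogonal to \<open>x\<close>, and nonzero because \<open>x 0 = 1\<close>;
      where the gradient of \<open>f\<close> vanishes the minors impose nothing.\<close>
    define v :: "nat \<Rightarrow> 'a mpoly" where "v i = (if i = 0 then - V 1 else if i = 1 then V 0 else 0)" for i
    have "(\<Sum>i\<le>n. x i * E (v i) x) = (\<Sum>i\<in>{0,1}. x i * E (v i) x)"
      using n by (intro sum.mono_neutral_right) (auto simp: v_def)
    also have "\<dots> = 0" using x0 by (simp add: v_def ac.ev_simps)
    finally have "tang n l x f v"
      using False x0 fx l n unfolding tang_def by (auto simp: v_def intro!: exI[of _ 1])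
    moreover have "v i \<in> S n 1" for i using n by (simp add: v_def S_uminus S_V del: One_nat_def)
    ultimately show ?thesis by blast
  qed
  then obtain v D' where v: "\<And>i. v i \<in> S n D'" and tv: "tang n l x f v" by blast
  define s :: "'a mpoly" where "s = V 2 * V 0 ^ (B - 1) - V 1 ^ B"
  have s: "s \<in> S n B" unfolding s_def
    using n e by (intro S_diff S_mult'[OF S_V S_V_power] S_V_power) auto
  \<comment> \<open>where \<open>x\<^sub>0 = 1\<close>, \<open>h\<close> is 0 at the points over the field with \<open>R\<close> elements and 1 at \<open>x\<close>\<close>
  define h where "h = s ^ R - s * V 0 ^ (B * (R - 1))"
  have "B * R = B + B * (R - 1)" using R by (cases R) auto
  then have h: "h \<in> S n (B * R)" unfolding h_def
    by (intro S_diff S_power[OF s] S_mult'[OF s S_V_power]) auto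
  have Eh: "E h y = (y 2 - y 1 ^ B) ^ R - (y 2 - y 1 ^ B)" if "y 0 = 1" for y
    using that by (simp add: h_def s_def ac.ev_simps)
  \<comment> \<open>\<open>h\<close> switches from \<open>g\<close> to \<open>v\<close>; the powers
    of \<open>V 0\<close> only equalize degrees.\<close>
  define g' where "g' i = g i * (V 0 ^ (B * R) - h) * V 0 ^ D' + h * v i * V 0 ^ D" for i
  have g': "g' i \<in> S n (D + B * R + D')" for i
    unfolding g'_def
    by (intro S_add S_mult'[OF S_mult[OF g S_diff[OF S_V_power h]] S_V_power]
        S_mult'[OF S_mult[OF h v] S_V_power]) auto
  have new: "E (g' i) x = E (v i) x" for i
    using x0 by (simp add: g'_def ac.ev_simps Eh xc[unfolded One_nat_def] c)
  have old: "E (g' i) y = E (g i) y" if "tang n k y f' g" for i y f'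
  proof -
    have y0: "y 0 = 1" and "\<forall>i\<le>n. fixd k (y i)"
      using that by (simp_all add: tang_def)
    then have "fixd k (y 2)" "fixd k (y 1)" using n by simp_all
    then have "fixd k (y 2 - y 1 ^ B)" by (intro fixd_diff fixd_power)
    then have "E h y = 0" by (simp add: Eh y0 fixd_def R_def)
    then show ?thesis by (simp add: g'_def ac.ev_simps y0)
  qed
  have "\<exists>y. tang n l y f' g'" if f': "f' \<in> insert f Fs" for f'
  proof (cases "f' = f")
    case True
    then show ?thesis using tang_cong[OF tv dvd_refl, of g'] new by auto
  next
    case False
    then obtain y where y: "tang n k y f' g" using Fs f' by blast
    show ?thesis using tang_cong[OF y l(2), of g'] old[OF y] by auto
  qed
  then have "l > 0 \<and> (\<forall>i. g' i \<in> S n (D + B * R + D')) \<and> (\<forall>f'\<in>insert f Fs. \<exists>x. tang n l x f' g')"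
    using l(1) g' by simp
  then show ?case by (intro exI)
qed

subsection \<open>Irreducibility\<close>

interpretation idh: coeff_hom "\<lambda>a :: 'a::comm_ring_1. a"
  by unfold_locales auto

lemma mpeval_ev: "mpeval p x = ev (\<lambda>a. a) x p"
  by (simp add: mpeval_def ev_def mev_def)

lemma prod_monom:
  "(\<Prod>i\<in>A. Polynomial.monom (f i) (h i)) = Polynomial.monom (\<Prod>i\<in>A. f i) (\<Sum>i\<in>A. h i)"
  by (induction A rule: infinite_finite_induct) (auto simp: mult_monom)

lemma V_power: "V i ^ k = sgl (sgl i k) (1 :: 'a::comm_ring_1)"
proof (induction k)
  case (Suc k)
  then show ?case by (simp add: V_def mult_single flip: single_add)
qed simp

lemma prod_sgl: "(\<Prod>i\<in>A. sgl (h i) (1 :: 'a::comm_ring_1)) = (sgl (\<Sum>i\<in>A. h i) 1 :: 'a mpoly)"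
  by (induction A rule: infinite_finite_induct) (auto simp: mult_single)

lemma mev_V: "mev V m = sgl m (1 :: 'a::comm_ring_1)"
proof -
  have "mev V m = sgl (\<Sum>i\<in>ks m. sgl i (lkp m i)) (1 :: 'a)"
    by (simp add: mev_def V_power prod_sgl)
  then show ?thesis by (simp flip: mpoly_as_sum)
qed

text \<open>The substitution \<open>x\<^sub>i \<mapsto> x\<^sub>i T\<close>, whose degree in \<open>T\<close> is the total degree.\<close>

definition grade :: "'a::comm_ring_1 mpoly \<Rightarrow> 'a mpoly poly" where
  "grade = ev (\<lambda>c. [:sgl 0 c:]) (\<lambda>i. Polynomial.monom (V i) 1)"

interpretation gr: coeff_hom "\<lambda>c :: 'a::comm_ring_1. [:sgl 0 c:] :: 'a mpoly poly"
  by unfold_locales (auto simp: pCons_one single_add mult_single mult.commute)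

lemma grade_mult: "grade (p * q) = grade p * grade q"
  by (simp add: grade_def gr.ev_mult)

lemma grade_eq: "grade p = (\<Sum>m\<in>ks p. Polynomial.monom (sgl m (lkp p m)) (mdeg m))"
proof -
  have "mev (\<lambda>i. Polynomial.monom (V i) 1) m = Polynomial.monom (sgl m (1 :: 'a)) (mdeg m)" for m
  proof -
    have "mev (\<lambda>i. Polynomial.monom (V i) 1) m = Polynomial.monom (mev V m :: 'a mpoly) (mdeg m)"
      by (simp add: mev_def mdeg_def monom_power prod_monom)
    then show ?thesis by (simp add: mev_V)
  qed
  then show ?thesis
    by (simp add: grade_def ev_def smult_monom mult_single)
qed

lemma grade_homogeneous:
  assumes "p \<in> S n e"
  shows "grade p = Polynomial.monom p e"
proof -
  have "grade p = (\<Sum>m\<in>ks p. Polynomial.monom (sgl m (lkp p m)) e)"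
    unfolding grade_eq using assms by (intro sum.cong) (auto simp: S_def)
  also have "\<dots> = Polynomial.monom (\<Sum>m\<in>ks p. sgl m (lkp p m)) e"
    by (rule poly_eqI) (simp add: Polynomial.coeff_sum)
  finally show ?thesis by (simp flip: mpoly_as_sum)
qed

text \<open>\<open>grade\<close> keeps each monomial inside a coefficient, so no cancellation can
  lower the degree.\<close>

lemma mdeg_le_grade:
  assumes "m \<in> ks p"
  shows "mdeg m \<le> Polynomial.degree (grade p)"
proof (rule le_degree)
  have "lkp (Polynomial.coeff (grade p) (mdeg m)) m =
      (\<Sum>m'\<in>ks p. if m' = m then lkp p m' else 0)"
    unfolding grade_eq Polynomial.coeff_sum lookup_sum
    by (intro sum.cong refl) (auto simp: lookup_single when_def)
  also have "\<dots> = lkp p m" using assms by simp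
  finally show "Polynomial.coeff (grade p) (mdeg m) \<noteq> 0"
    using assms by (auto simp: in_keys_iff)
qed

lemma degree_line:
  fixes p :: "'a::idom mpoly"
  shows "Polynomial.degree (ev (\<lambda>c. [:c:]) (\<lambda>i. [:a i, b i:]) p) \<le> Polynomial.degree (grade p)"
  unfolding ev_def
proof (rule degree_sum_le)
  fix m assume m: "m \<in> ks p"
  have "Polynomial.degree (mev (\<lambda>i. [:a i, b i:]) m) \<le>
      (\<Sum>i\<in>ks m. Polynomial.degree ([:a i, b i:] ^ lkp m i))"
    unfolding mev_def using degree_prod_sum_le[of "ks m" "\<lambda>i. [:a i, b i:] ^ lkp m i"]
    by (simp add: comp_def)
  also have "\<dots> \<le> (\<Sum>i\<in>ks m. lkp m i)"
  proof (rule sum_mono)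
    fix i
    have "Polynomial.degree ([:a i, b i:] ^ lkp m i) \<le> Polynomial.degree [:a i, b i:] * lkp m i"
      by (rule degree_power_le)
    also have "\<dots> \<le> 1 * lkp m i" by (intro mult_right_mono) auto
    finally show "Polynomial.degree ([:a i, b i:] ^ lkp m i) \<le> lkp m i" by simp
  qed
  also have "\<dots> \<le> Polynomial.degree (grade p)"
    using mdeg_le_grade[OF m] by (simp add: mdeg_def)
  finally have le: "Polynomial.degree (mev (\<lambda>i. [:a i, b i:]) m) \<le> Polynomial.degree (grade p)" .
  show "Polynomial.degree ([:lkp p m:] * mev (\<lambda>i. [:a i, b i:]) m) \<le> Polynomial.degree (grade p)"
    using le order_trans[OF degree_smult_le] by simp
qed simp

text \<open>By smoothness only one of two factors vanishes at \<open>a\<close>. The other one has no zero on the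
  line, so the first one carries the whole degree of the product.\<close>

lemma irreducible_if_power_on_line:
  fixes F :: "'a::alg_closed_field mpoly"
  assumes F: "F \<in> S n e" and e: "e > 0"
    and line: "\<And>y. mpeval F (\<lambda>i. a i + y * b i) = y ^ e"
    and smooth: "mpeval (pd F j) a \<noteq> 0"
  shows "irreducible F"
proof (rule irreducibleI)
  have Fa: "mpeval F a = 0" using line[of 0] e by simp
  show "F \<noteq> 0" using smooth by (auto simp: mpeval_ev)
  then have F0: "F \<noteq> 0" .
  show "\<not> F dvd 1"
  proof
    assume "F dvd 1"
    then obtain G where "1 = F * G" by (elim dvdE)
    then have "mpeval (F * G) a = 1" by (simp add: mpeval_ev flip: \<open>1 = F * G\<close>)
    then show False using Fa by (simp add: mpeval_ev idh.ev_mult)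
  qed
  have unit: "H dvd 1" if GH: "F = G * H" and Ha: "mpeval H a \<noteq> 0" for G H
  proof -
    let ?L = "ev (\<lambda>c. [:c:]) (\<lambda>i. [:a i, b i:])"
    have pL: "poly (?L p) y = mpeval p (\<lambda>i. a i + y * b i)" for p y
      by (simp add: mpeval_ev ev_def mev_def poly_sum poly_prod)
    have LGH: "poly (?L G) y * poly (?L H) y = y ^ e" for y
      unfolding pL line[symmetric] GH by (simp add: mpeval_ev idh.ev_mult)
    have "poly (?L H) y \<noteq> 0" for y
    proof
      assume y: "poly (?L H) y = 0"
      then have "y = 0" using LGH[of y] e by simp
      then show False using y Ha by (simp add: pL)
    qed
    then have "Polynomial.degree (?L H) = 0"
      using alg_closed_imp_poly_has_root[of "?L H"] by blast
    then obtain u where u: "?L H = [:u:]" by (metis degree_eq_zeroE)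
    have "e \<le> Polynomial.degree (?L G)"
    proof (rule ccontr)
      assume lt: "\<not> ?thesis"
      \<comment> \<open>If the restriction of \<open>G\<close> had degree below \<open>e\<close>,
        this polynomial would have a root, and there the product identity would give 1 = 0.\<close>
      let ?q = "Polynomial.monom 1 e + ([:1:] - Polynomial.smult u (?L G))"
      have "Polynomial.degree ([:1:] - Polynomial.smult u (?L G)) < e"
        using lt e order_le_less_trans[OF degree_smult_le] by (intro degree_diff_less) auto
      then have "Polynomial.degree ?q = e" by (subst degree_add_eq_left) (auto simp: degree_monom_eq)
      then obtain y where "poly ?q y = 0" using alg_closed_imp_poly_has_root[of ?q] e by auto
      then have "y ^ e + (1 - u * poly (?L G) y) = 0" by (simp add: poly_monom)
      moreover have "u * poly (?L G) y = y ^ e" using LGH[of y] by (simp add: u mult.commute)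
      ultimately show False by simp
    qed
    then have "e \<le> Polynomial.degree (grade G)" using degree_line[of a b G] by simp
    \<comment> \<open>Degrees of gradings add up to \<open>e\<close>, all of which \<open>G\<close>
      already uses; so \<open>H\<close> is constant.\<close>
    moreover have "Polynomial.degree (grade G) + Polynomial.degree (grade H) = e"
    proof -
      have eq: "grade G * grade H = Polynomial.monom F e"
        using grade_homogeneous[OF F] by (simp add: GH grade_mult)
      then have "grade G \<noteq> 0" "grade H \<noteq> 0" using F0 by auto
      then show ?thesis using eq F0 degree_monom_eq by (metis degree_mult_eq)
    qed
    ultimately have "Polynomial.degree (grade H) = 0" by simp
    then have "ks H \<subseteq> {0}" using mdeg_le_grade[of _ H] by (auto simp: mdeg_eq_0_iff)
    then have H: "H = sgl 0 (lkp H 0)"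
      by (intro poly_mapping_eqI) (auto simp: lookup_single when_def in_keys_iff)
    then have "lkp H 0 \<noteq> 0" using F0 GH by (metis mult_zero_right single_zero)
    then have "1 = H * sgl 0 (inverse (lkp H 0))"
      by (subst H) (simp add: mult_single)
    then show ?thesis by (rule dvdI)
  qed
  fix G H assume GH: "F = G * H"
  have "mpeval G a \<noteq> 0 \<or> mpeval H a \<noteq> 0"
    using smooth by (auto simp: GH pd_mult mpeval_ev idh.ev_add idh.ev_mult)
  then show "G dvd 1 \<or> H dvd 1"
    using unit[of G H] unit[of H G] GH by (auto simp: mult.commute)
qed

subsection \<open>The hypersurface\<close>

text \<open>Serves both as tangency point for the multiples of powers of \<open>x 0\<close> and as
  base point of the line in the irreducibility argument.\<close>

definition pt1 :: "nat \<Rightarrow> 'k::zero_neq_one" where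
  "pt1 i = (if i = 1 then 1 else 0)"

text \<open>Common zeros of the interpolating forms are removed while the values at the chosen
  points are kept. The prescribed shape on \<open>x 0 = 0\<close> leaves only component 0 of the
  gradient at \<open>pt1\<close> and makes the final form a pure power on a line through it.\<close>

lemma ex_tangent_system:
  fixes Fs :: "'a::{finite,field} mpoly set"
  assumes fin: "finite Fs" and n: "2 \<le> n"
    and Fs: "\<And>f. f \<in> Fs \<Longrightarrow> \<exists>e<B. f \<in> S n e \<and> (\<exists>m\<in>ks f. m \<noteq> sgl 0 e)"
  shows "\<exists>A N k. k > 0 \<and> N > 0 \<and> (\<forall>c::'a. fixd k (to_ac c)) \<and> (\<forall>i\<le>n. A i \<in> S n N) \<and> (\<forall>f\<in>Fs. \<exists>x. tang n k x f A) \<and>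
    (\<forall>x. proj_point n x \<longrightarrow> (\<exists>i\<le>n. E (A i) x \<noteq> 0)) \<and>
    (\<forall>x. x 0 = 0 \<longrightarrow> E (A 0) x = x 1 ^ N \<and> E (A 1) x = 0 \<and> (\<forall>i\<in>{2..n}. E (A i) x = x i ^ N))"
proof -
  obtain g D k0 where k0: "k0 > 0" and g: "\<And>i. g i \<in> S n D"
    and g0: "\<And>f. f \<in> Fs \<Longrightarrow> \<exists>x. tang n k0 x f g"
    using interpolation[OF fin n Fs] by blast
  obtain k where k: "k > 0" "k0 dvd k" "\<And>c::'a. fixd k (to_ac c)"
    using ex_fixd_finite[of "range (to_ac :: 'a \<Rightarrow> _)" k0] k0 by auto
  have gk: "\<exists>x. tang n k x f g" if "f \<in> Fs" for f
    using g0[OF that] tang_cong[OF _ k(2), of n _ f g g] by blast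
  define R where "R = CHAR('a) ^ k"
  have R: "R \<ge> 2" unfolding R_def using k(1) by (rule CHAR_power_ge_2)
  \<comment> \<open>Being a power of \<open>R\<close>, the exponent \<open>r\<close> fixes the
    coordinates of the interpolation points; its size keeps the subtractions in \<open>G\<close>
    from truncating.\<close>
  define r where "r = R ^ (D + 2)"
  have "D + 2 < 2 ^ (D + 2)" by (rule less_exp)
  also have "2 ^ (D + 2) \<le> R ^ (D + 2)" using R by (intro power_mono) auto
  finally have r: "r \<ge> D + 2" by (simp add: r_def)
  \<comment> \<open>The position 1 is kept for the form that is chosen last.\<close>
  define \<sigma> :: "nat \<Rightarrow> nat" where "\<sigma> i = (if i = 1 then 0 else i)" for i
  \<comment> \<open>At an interpolation point the second term cancels \<open>x i ^ r\<close> in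
    \<open>Bf i\<close>, which leaves the value of \<open>g (\<sigma> i)\<close>.\<close>
  define G where "G i = V 0 ^ (r - 1 - D) * g (\<sigma> i) - V 0 ^ (r - 2) * V i" for i
  have G: "G i \<in> S n (r - 1)" if "i \<in> {1..n}" for i
    unfolding G_def using that r
    by (intro S_diff S_mult'[OF S_V_power g] S_mult'[OF S_V_power S_V]) auto
  define Bf where "Bf i = V i ^ r + V 0 * G i" for i
  have Bf: "Bf i \<in> S n r" if "i \<in> {1..n}" for i
    unfolding Bf_def using that r by (intro S_add S_V_power S_mult'[OF S_V G]) auto
  have Bf_tang: "E (Bf i) x = E (g (\<sigma> i)) x" if "tang n k x f g" "i \<in> {1..n}" for i x f
  proof -
    have "x 0 = 1" "fixd k (x i)" using that by (auto simp: tang_def)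
    moreover from this have "x i ^ r = x i" unfolding r_def R_def by (intro power_fixd)
    ultimately show ?thesis by (simp add: Bf_def G_def ac.ev_simps)
  qed
  have Bf_inf: "E (Bf i) x = x i ^ r" if "x 0 = 0" for i x
    using that by (simp add: Bf_def ac.ev_simps)
  have "r > 0" using r by simp
  then obtain U :: "'a alg_closure set" where U: "finite U"
    "\<And>w i. w 0 = 1 \<Longrightarrow> (\<And>i. i \<in> {1..n} \<Longrightarrow> E (Bf i) w = 0) \<Longrightarrow> i \<le> n \<Longrightarrow> w i \<in> U"
    using finite_common_zeros[of r n G] G unfolding Bf_def by blast
  \<comment> \<open>One finite field now contains the coordinates of the interpolation points and of
    the affine common zeros of the \<open>Bf i\<close>; the last form need only be controlled over
    it.\<close>
  obtain l where l: "l > 0" "k dvd l" "\<And>x. x \<in> U \<Longrightarrow> fixd l x"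
    using ex_fixd_finite[OF U(1) k(1)] by blast
  have lc: "fixd l (to_ac c)" for c :: 'a using fixd_dvd[OF k(3) l(2)] .
  define Q where "Q = CHAR('a) ^ l"
  have Q: "Q \<ge> 2" unfolding Q_def using l(1) by (rule CHAR_power_ge_2)
  define q where "q = Q - 1"
  have q: "q > 0" using Q by (simp add: q_def)
  \<comment> \<open>On the field with \<open>Q\<close> elements \<open>v ^ q\<close> is the
    indicator of \<open>v \<noteq> 0\<close>, so case distinctions can be written as
    polynomials.\<close>
  have fixd_q: "v ^ q = (if v = 0 then 0 else 1)" if "fixd l v" for v :: "'a alg_closure"
  proof (cases "v = 0")
    case False
    have "Suc q = Q" using Q by (simp add: q_def)
    moreover have "v ^ Q = v" using that by (simp add: fixd_def Q_def)
    ultimately have "v * v ^ q = v * 1" by (metis power_Suc mult_1_right)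
    then show ?thesis using False by simp
  qed (use q in simp)
  \<comment> \<open>Where \<open>x\<^sub>0 = 1\<close>, over the field with \<open>Q\<close> elements, the second summand is nonzero only if all
    \<open>Bf i\<close> and \<open>g 1\<close> vanish, which does not happen at the interpolation points.\<close>
  define b where "b = g 1 * V 0 ^ (D * q + r * q * n) +
    V 0 ^ D * (V 0 ^ (D * q) - g 1 ^ q) * (\<Prod>i\<in>{1..n}. V 0 ^ (r * q) - Bf i ^ q)"
  define D1 where "D1 = D + D * q + r * q * n"
  have b: "b \<in> S n D1" unfolding b_def
  proof (rule S_add)
    show "g 1 * V 0 ^ (D * q + r * q * n) \<in> S n D1"
      by (rule S_mult'[OF g S_V_power]) (auto simp: D1_def)
    have "V 0 ^ D * (V 0 ^ (D * q) - g 1 ^ q) \<in> S n (D + D * q)"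
      by (intro S_mult S_V_power S_diff S_power g) auto
    moreover have "(\<Prod>i\<in>{1..n}. V 0 ^ (r * q) - Bf i ^ q) \<in> S n (r * q * card {1..n})"
      by (intro S_prod S_diff S_V_power S_power Bf) auto
    ultimately show "V 0 ^ D * (V 0 ^ (D * q) - g 1 ^ q) * (\<Prod>i\<in>{1..n}. V 0 ^ (r * q) - Bf i ^ q) \<in> S n D1"
      by (rule S_mult') (simp add: D1_def)
  qed
  have Eb: "E b x = E (g 1) x + (1 - E (g 1) x ^ q) * (\<Prod>i\<in>{1..n}. 1 - E (Bf i) x ^ q)"
    if "x 0 = 1" for x
    using that by (simp add: b_def ac.ev_simps)
  \<comment> \<open>The power \<open>T\<close> preserves zeros and all values in the field with
    \<open>Q\<close> elements, and lifts the degree above \<open>D1\<close>.\<close>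
  define T where "T = Q ^ (D1 + 1)"
  have "D1 + 1 < 2 ^ (D1 + 1)" by (rule less_exp)
  also have "2 ^ (D1 + 1) \<le> Q ^ (D1 + 1)" using Q by (intro power_mono) auto
  also have "\<dots> \<le> r * Q ^ (D1 + 1)" using r by simp
  finally have T: "r * T > D1" by (simp add: T_def)
  have T0: "T > 0" unfolding T_def using Q by simp
  have powT: "v ^ T = v" if "fixd l v" for v :: "'a alg_closure"
    unfolding T_def Q_def using that by (rule power_fixd)
  \<comment> \<open>As \<open>r * T > D1\<close>, the padding of \<open>b\<close> contains a factor
    \<open>V 0\<close>; hence \<open>A 1\<close> vanishes on \<open>x 0 = 0\<close>.\<close>
  define A where "A i = (if i = 0 then Bf 1 ^ T else if i = 1 then b * V 0 ^ (r * T - D1) else Bf i ^ T)" for i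
  have A: "A i \<in> S n (r * T)" if "i \<le> n" for i
    unfolding A_def using that n T by (auto intro!: S_power Bf S_mult'[OF b S_V_power])
  have A_inf: "E (A 0) x = x 1 ^ (r * T) \<and> E (A 1) x = 0 \<and> (\<forall>i\<in>{2..n}. E (A i) x = x i ^ (r * T))"
    if "x 0 = 0" for x
    using that T by (auto simp: A_def ac.ev_simps Bf_inf power_mult)
  have A_tang: "\<exists>x. tang n l x f A" if f: "f \<in> Fs" for f
  proof -
    obtain x where x: "tang n k x f g" using gk[OF f] by blast
    have x0: "x 0 = 1" using x by (simp add: tang_def)
    have fx: "fixd l (E (g i) x)" for i
      using x fixd_dvd[OF _ l(2)] by (intro fixd_E[OF g] lc) (auto simp: tang_def)
    have "E (A i) x = E (g i) x" if "i \<le> n" for i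
    proof -
      consider "i = 0" | "i = 1" | "i \<ge> 2" by linarith
      then show ?thesis
      proof cases
        case 1
        then show ?thesis using n Bf_tang[OF x, of 1] by (simp add: A_def ac.ev_simps \<sigma>_def powT fx)
      next
        case 3
        then show ?thesis using that Bf_tang[OF x, of i] by (simp add: A_def ac.ev_simps \<sigma>_def powT fx)
      next
        case 2
        have "(1 - E (g 1) x ^ q) * (\<Prod>i\<in>{1..n}. 1 - E (Bf i) x ^ q) = 0"
        proof (cases "\<exists>i\<in>{1..n}. E (Bf i) x \<noteq> 0")
          case True
          then obtain i where i: "i \<in> {1..n}" "E (Bf i) x \<noteq> 0" by blast
          then have "1 - E (Bf i) x ^ q = 0" using Bf_tang[OF x i(1)] by (simp add: fixd_q fx)
          then show ?thesis using i(1) by (auto simp: prod_zero_iff)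
        next
          case False
          \<comment> \<open>\<open>\<sigma>\<close> maps \<open>{1..n}\<close> onto the indices
            other than 1, so only \<open>g 1\<close> can be nonzero at \<open>x\<close>.\<close>
          have "E (g i) x = 0" if "i \<le> n" "i \<noteq> 1" for i
          proof (cases "i = 0")
            case True
            then show ?thesis using False Bf_tang[OF x, of 1] n by (simp add: \<sigma>_def)
          next
            case i: False
            then show ?thesis using False Bf_tang[OF x, of i] n that by (simp add: \<sigma>_def)
          qed
          then have "E (g 1) x \<noteq> 0" using x unfolding tang_def by metis
          then show ?thesis by (simp add: fixd_q fx)
        qed
        then have "E b x = E (g 1) x" using Eb[of x, OF x0] by simp
        then show ?thesis using 2 x0 by (simp add: A_def ac.ev_simps)
      qed
    qed
    then show ?thesis using tang_cong[OF x l(2), of A] by blast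
  qed
  have A_zero: "\<exists>i\<le>n. E (A i) x \<noteq> 0" if x: "proj_point n x" for x
  proof (rule ccontr)
    assume "\<not> ?thesis"
    then have z: "E (A i) x = 0" if "i \<le> n" for i using that by blast
    show False
    proof (cases "x 0 = 0")
      case True
      have "x i = 0" if i: "i \<le> n" for i
      proof -
        consider "i = 0" | "i = 1" | "i \<in> {2..n}" using i by force
        then show ?thesis
          using True A_inf[of x, OF True] z[of 0] z[OF i] by cases (auto split: if_splits)
      qed
      then show False using x by (auto simp: proj_point_def)
    next
      case False
      define y where "y i = inverse (x 0) * x i" for i
      have y0: "y 0 = 1" using False by (simp add: y_def)
      have zy: "E (A i) y = 0" if "i \<le> n" for i
        using ac.ev_scale[OF A[OF that], of "inverse (x 0)" x] z[OF that] by (simp add: y_def[abs_def])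
      have By: "E (Bf i) y = 0" if "i \<in> {1..n}" for i
      proof (cases "i = 1")
        case True
        then show ?thesis using zy[of 0] by (simp add: A_def ac.ev_simps)
      next
        case i: False
        then show ?thesis using zy[of i] that by (simp add: A_def ac.ev_simps)
      qed
      have "fixd l (y i)" if "i \<le> n" for i by (intro l(3) U(2) y0 By that)
      then have fy: "fixd l (E (g 1) y)" by (intro fixd_E[OF g] lc)
      have "E b y = 0" using zy[of 1] n y0 by (simp add: A_def ac.ev_simps)
      \<comment> \<open>This is 1 if \<open>g 1\<close> vanishes at \<open>y\<close> and the value
        of \<open>g 1\<close> otherwise, so never 0.\<close>
      moreover have "E b y = E (g 1) y + (1 - E (g 1) y ^ q)"
        using Eb[of y, OF y0] q by (simp add: By zero_power)
      ultimately show False using fixd_q[OF fy] by (simp split: if_splits)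
    qed
  qed
  have "r * T > 0" using r T0 by simp
  then show ?thesis using l(1) lc A A_tang A_zero A_inf by blast
qed

text \<open>The derivative of a \<open>CHAR('a) ^ l\<close>-th power carries a factor that is zero
  in \<open>'a\<close>, so only the variable in front contributes.\<close>

lemma pd_frobenius_sum:
  fixes A :: "nat \<Rightarrow> 'a::{finite,field} mpoly"
  assumes "l > 0" "j \<le> n"
  shows "pd (\<Sum>i\<le>n. V i * A i ^ (CHAR('a) ^ l)) j = A j ^ (CHAR('a) ^ l)"
proof -
  have "of_nat (CHAR('a) ^ l) = (0 :: 'a)" using assms(1) by simp
  then have "of_nat (CHAR('a) ^ l) = (0 :: 'a mpoly)" by (metis single_of_nat single_zero)
  then have "pd (V i * A i ^ (CHAR('a) ^ l)) j = (if i = j then A i ^ (CHAR('a) ^ l) else 0)" for i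
    unfolding pd_mult pd_power by (simp add: pd_V)
  then show ?thesis using assms(2) by (simp add: pd_sum)
qed

theorem theorem3p1:
  fixes n d :: nat
  assumes "n \<ge> 2" and "d \<ge> 1"
  shows "\<exists>(F :: ('a::{finite,field}) mpoly) e.
           e \<ge> 1 \<and> F \<in> S n e \<and> smooth_hypersurface n F \<and> irreducible (lift F) \<and>
           (\<forall>e'\<in>{1..d}. \<forall>f\<in>S n e'. \<not> isect_smooth_codim2 n f F)"
proof -
  \<comment> \<open>The forms left out are the multiples of \<open>V 0 ^ e\<close>, including 0;
    they are handled at \<open>pt1\<close>.\<close>
  define Fs :: "'a mpoly set" where
    "Fs = (\<Union>e\<in>{1..d}. {f \<in> S n e. \<exists>m\<in>ks f. m \<noteq> sgl 0 e})"
  have "finite Fs" unfolding Fs_def by (auto intro: finite_subset[OF _ finite_S])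
  moreover have "\<exists>e<Suc d. f \<in> S n e \<and> (\<exists>m\<in>ks f. m \<noteq> sgl 0 e)" if f: "f \<in> Fs" for f
  proof -
    obtain e where "e \<in> {1..d}" "f \<in> S n e" "\<exists>m\<in>ks f. m \<noteq> sgl 0 e"
      using f unfolding Fs_def by blast
    then show ?thesis by (intro exI[of _ e]) auto
  qed
  ultimately obtain A N l where l: "l > 0" and N: "N > 0" and lc: "\<And>c::'a. fixd l (to_ac c)"
    and A: "\<And>i. i \<le> n \<Longrightarrow> A i \<in> S n N"
    and A_tang: "\<And>f. f \<in> Fs \<Longrightarrow> \<exists>x. tang n l x f A"
    and A_zero: "\<And>x. proj_point n x \<Longrightarrow> \<exists>i\<le>n. E (A i) x \<noteq> 0"
    and A_inf: "\<And>x. x 0 = 0 \<Longrightarrow> E (A 0) x = x 1 ^ N \<and> E (A 1) x = 0 \<and> (\<forall>i\<in>{2..n}. E (A i) x = x i ^ N)"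
    using ex_tangent_system[of Fs n "Suc d"] assms(1) by metis
  define Q where "Q = CHAR('a) ^ l"
  have Q: "Q > 0" unfolding Q_def using CHAR_power_ge_2[OF l, where 'a='a] by linarith
  define F where "F = (\<Sum>i\<le>n. V i * A i ^ Q)"
  define e where "e = 1 + N * Q"
  have F: "F \<in> S n e" unfolding F_def e_def
    by (intro S_sum S_mult S_V S_power A) auto
  have EF: "E F x = (\<Sum>i\<le>n. x i * E (A i) x ^ Q)" for x
    by (simp add: F_def ac.ev_simps)
  have pdF: "E (pd F j) x = E (A j) x ^ Q" if "j \<le> n" for x j
    using pd_frobenius_sum[OF l that, of A] by (simp add: F_def Q_def ac.ev_power)
  have smooth: "\<exists>i\<le>n. mpeval (pd (lift F) i) x \<noteq> 0" if "proj_point n x" for x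
    using A_zero[OF that] pdF by (auto simp: mpeval_pd_lift)
  have pp: "proj_point n (pt1 :: nat \<Rightarrow> 'a alg_closure)"
    using assms(1) by (auto simp: proj_point_def pt1_def intro!: exI[of _ 1])
  \<comment> \<open>On the line through \<open>pt1\<close> in direction of coordinate 2,
    \<open>A 1\<close> vanishes, so only the summand with index 2 survives.\<close>
  have line: "E F (\<lambda>i. pt1 i + y * (if i = 2 then 1 else 0)) = y ^ e" for y
  proof -
    let ?x = "\<lambda>i. pt1 i + y * (if i = (2::nat) then 1 else 0)"
    have x: "?x 0 = 0" by (simp add: pt1_def)
    have "?x i * E (A i) ?x ^ Q = (if i = 2 then y ^ e else 0)" if "i \<le> n" for i
    proof -
      consider "i = 0" | "i = 1" | "i = 2" | "i > 2" by linarith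
      then show ?thesis
      proof cases
        case 3
        then have "E (A i) ?x = y ^ N" using A_inf[of ?x, OF x] assms(1) by (simp add: pt1_def)
        then show ?thesis using 3 by (simp add: e_def pt1_def power_mult)
      qed (use A_inf[of ?x, OF x] Q in \<open>simp_all add: pt1_def\<close>)
    qed
    then have "E F ?x = (\<Sum>i\<le>n. if i = 2 then y ^ e else 0)" unfolding EF by (intro sum.cong) auto
    then show ?thesis using assms(1) by simp
  qed
  have EF1: "E F pt1 = 0" using line[of 0] by (simp add: e_def)
  obtain j where j: "mpeval (pd (lift F) j) pt1 \<noteq> 0" using smooth[OF pp] by blast
  have irr: "irreducible (lift F)"
  proof (rule irreducible_if_power_on_line)
    show "lift F \<in> S n e" using F by (simp add: S_def)
    show "mpeval (lift F) (\<lambda>i. pt1 i + y * (if i = 2 then 1 else 0)) = y ^ e" for y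
      using line[of y] by (simp add: mpeval_lift)
  qed (use j in \<open>auto simp: e_def\<close>)
  have "\<not> isect_smooth_codim2 n f F" if e': "e' \<in> {1..d}" and f: "f \<in> S n e'" for e' f
  proof (cases "f \<in> Fs")
    case True
    then obtain x where x: "tang n l x f A" using A_tang by blast
    \<comment> \<open>Coefficients and coordinates lie in the field with \<open>Q\<close> elements,
      hence so do the values, and the exponent \<open>Q\<close> has no effect at
      \<open>x\<close>.\<close>
    have Ax: "E (A i) x ^ Q = E (A i) x" if "i \<le> n" for i
      using fixd_E[OF A[OF that] lc, of x] x by (simp add: tang_def fixd_def Q_def)
    have "E F x = (\<Sum>i\<le>n. x i * E (A i) x)" by (simp add: EF Ax)
    then have "E F x = 0" using x by (simp add: tang_def)
    moreover have "proj_point n x" using x by (auto simp: tang_def proj_point_def intro!: exI[of _ 0])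
    moreover have "E (pd f i) x * E (pd F j) x = E (pd f j) x * E (pd F i) x"
      if "i \<le> n" "j \<le> n" for i j
      using x that by (simp add: pdF Ax tang_def)
    moreover have "E f x = 0" using x by (simp add: tang_def)
    ultimately show ?thesis
      unfolding isect_smooth_codim2_def mpeval_lift mpeval_pd_lift by blast
  next
    case False
    have keys: "m = sgl 0 e'" if "m \<in> ks f" for m using False e' f that by (auto simp: Fs_def)
    have f_eq: "f = sgl (sgl 0 e') (lkp f (sgl 0 e'))"
      using keys by (intro poly_mapping_eqI) (auto simp: lookup_single when_def in_keys_iff)
    \<comment> \<open>Here \<open>e' \<ge> 1\<close> matters: a nonzero constant would have no
      zero.\<close>
    have "E f pt1 = 0"
      using e' by (subst f_eq) (simp add: ac.ev_single pt1_def)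
    moreover have pdf: "E (pd f i) pt1 = 0" if "i \<noteq> 0" for i
      using that by (subst f_eq) (simp add: pd_single lookup_single)
    have pt1_0: "pt1 0 = (0 :: 'a alg_closure)" by (simp add: pt1_def)
    \<comment> \<open>At \<open>pt1\<close> both gradients have at most their component 0, so all
      minors vanish.\<close>
    have "E (A i) pt1 = 0" if "i \<le> n" "i \<noteq> 0" for i
    proof (cases "i = 1")
      case False
      then have "i \<in> {2..n}" using that by auto
      then have "E (A i) pt1 = pt1 i ^ N" using A_inf[of pt1, OF pt1_0] by blast
      then show ?thesis using False N by (simp add: pt1_def)
    qed (use A_inf[of pt1, OF pt1_0] in simp)
    then have pdF0: "E (pd F i) pt1 = 0" if "i \<le> n" "i \<noteq> 0" for i
      using that Q by (simp add: pdF)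
    have "E (pd f i) pt1 * E (pd F j) pt1 = E (pd f j) pt1 * E (pd F i) pt1"
      if "i \<le> n" "j \<le> n" for i j
      using that by (cases "i = 0"; cases "j = 0") (simp_all add: pdf pdF0)
    ultimately show ?thesis
      using pp EF1 unfolding isect_smooth_codim2_def mpeval_lift mpeval_pd_lift by blast
  qed
  then show ?thesis
    using F irr smooth unfolding smooth_hypersurface_def
    by (intro exI[of _ F] exI[of _ e]) (auto simp: e_def)
qed

end
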